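(* For all density matrices $\rho,\sigma$ of size $n\times n$ and all $t\in[0,1]$, $$1-\mathsf{F}_t^{\mathrm{spec}}(\rho,\sigma)\ \le\ \tfrac12\,\|\rho-\sigma\|_1.$$
   Context: A density matrix (density operator, state) is a positive semidefinite complex $n\times n$ matrix of trace one; $\|Y\|_1=\operatorname{Tr}\sqrt{Y^*Y}$ is the trace norm. For positive definite $A,B$, the matrix geometric mean is $A\sharp B=A^{1/2}(A^{-1/2}BA^{-1/2})^{1/2}A^{1/2}$, and the weighted spectral fidelity is $\mathsf{F}_t^{\mathrm{spec}}(\rho,\sigma)=\operatorname{Tr}\big(\rho\,(\rho^{-1}\sharp\sigma)^{2t}\big)$ for $t\in[0,1]$. Explicitly $\rho^{-1}\sharp\sigma=\rho^{-1/2}(\rho^{1/2}\sigma\rho^{1/2})^{1/2}\rho^{-1/2}$; for singular states this formula is used with inverse and fractional powers interpreted on the support of the corresponding operator (zero on its kernel), and $X^0=I$. *)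

theory Defs
  imports "Jordan_Normal_Form.Schur_Decomposition"
begin

definition mat_trace :: "complex mat \<Rightarrow> complex" where
  "mat_trace A = (\<Sum>i<dim_row A. A $$ (i, i))"

definition unitary_mat :: "nat \<Rightarrow> complex mat \<Rightarrow> bool" where
  "unitary_mat n U \<longleftrightarrow> U \<in> carrier_mat n n \<and> mat_adjoint U * U = 1\<^sub>m n"

(* The order on complex is that of Complex_Order: 0 \<le> z means that z is real and nonnegative. *)
definition psd_mat :: "nat \<Rightarrow> complex mat \<Rightarrow> bool" where
  "psd_mat n A \<longleftrightarrow> A \<in> carrier_mat n n \<and> mat_adjoint A = A \<and>
     (\<forall>v \<in> carrier_vec n. 0 \<le> (A *\<^sub>v v) \<bullet>c v)"

definition density_matrix :: "nat \<Rightarrow> complex mat \<Rightarrow> bool" where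
  "density_matrix n \<rho> \<longleftrightarrow> psd_mat n \<rho> \<and> mat_trace \<rho> = 1"

(* The relation B = f(A) of the functional calculus for Hermitian A: A = U diag(d) U* with U unitary
   and d real, and B = U diag(f d) U*.  By spectral_calculus_unique below, B does not depend on the
   chosen diagonalization; one exists exactly when A is Hermitian. *)
definition spectral_calculus :: "(real \<Rightarrow> real) \<Rightarrow> complex mat \<Rightarrow> complex mat \<Rightarrow> bool" where
  "spectral_calculus f A B \<longleftrightarrow> (\<exists>n U d. unitary_mat n U \<and>
     A = U * mat_diag n (\<lambda>i. complex_of_real (d i)) * mat_adjoint U \<and>
     B = U * mat_diag n (\<lambda>i. complex_of_real (f (d i))) * mat_adjoint U)"

definition mat_fun :: "(real \<Rightarrow> real) \<Rightarrow> complex mat \<Rightarrow> complex mat" where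
  "mat_fun f A = (THE B. spectral_calculus f A B)"

(* Powers of positive semidefinite matrices, taken on the support and zero on the kernel
   (0 powr s = 0 for every s, also for s < 0), except that the zeroth power is the identity. *)
definition mat_pow :: "complex mat \<Rightarrow> real \<Rightarrow> complex mat" where
  "mat_pow A s = mat_fun (\<lambda>x. if s = 0 then 1 else x powr s) A"

(* Taking the real part discards nothing: mat_adjoint Y * Y is positive semidefinite. *)
definition trace_norm :: "complex mat \<Rightarrow> real" where
  "trace_norm Y = Re (mat_trace (mat_pow (mat_adjoint Y * Y) (1/2)))"

definition geom_mean :: "complex mat \<Rightarrow> complex mat \<Rightarrow> complex mat" where
  "geom_mean A B =
     mat_pow A (1/2) * mat_pow (mat_pow A (-1/2) * B * mat_pow A (-1/2)) (1/2) * mat_pow A (1/2)"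

(* The trace is that of a product of two positive semidefinite matrices, hence real. For singular
   states mat_pow \<rho> (-1) is the inverse on the support; see geom_mean_inverse for the explicit
   form of the geometric mean used here. *)
definition spectral_fidelity :: "real \<Rightarrow> complex mat \<Rightarrow> complex mat \<Rightarrow> real" where
  "spectral_fidelity t \<rho> \<sigma> =
     Re (mat_trace (\<rho> * mat_pow (geom_mean (mat_pow \<rho> (-1)) \<sigma>) (2 * t)))"


lemma mat_adjoint_carrier: "U \<in> carrier_mat n n \<Longrightarrow> mat_adjoint U \<in> carrier_mat n n"
  unfolding mat_adjoint_def by auto

lemma unitary_mat_right:
  assumes "unitary_mat n U"
  shows "U * mat_adjoint U = 1\<^sub>m n"
  using assms mat_mult_left_right_inverse[of "mat_adjoint U" n U] mat_adjoint_carrier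
  unfolding unitary_mat_def by blast

lemma mult_mat_regroup:
  assumes "A \<in> carrier_mat n n" "B \<in> carrier_mat n n" "C \<in> carrier_mat n n"
    "D \<in> carrier_mat n n" "E \<in> carrier_mat n n"
  shows "A * (B * C * D) * E = (A * B) * C * (D * (E :: complex mat))"
proof -
  have "A * (B * C * D) = A * B * C * D"
    using assms by (simp add: assoc_mult_mat[of _ n n _ n _ n])
  moreover have "A * B * C * D * E = A * B * C * (D * E)"
    by (rule assoc_mult_mat[of _ n n _ n _ n]) (use assms in auto)
  ultimately show ?thesis by simp
qed

lemma spectral_calculus_unique:
  assumes "spectral_calculus f A B" and "spectral_calculus f A C"
  shows "B = C"
proof -
  let ?D = "\<lambda>n d. mat_diag n (\<lambda>i. complex_of_real (d i))"
  obtain n U d where U: "unitary_mat n U" and AU: "A = U * ?D n d * mat_adjoint U"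
    and B: "B = U * ?D n (\<lambda>i. f (d i)) * mat_adjoint U"
    using assms(1) unfolding spectral_calculus_def by blast
  obtain m V e where V: "unitary_mat m V" and AV: "A = V * ?D m e * mat_adjoint V"
    and C: "C = V * ?D m (\<lambda>i. f (e i)) * mat_adjoint V"
    using assms(2) unfolding spectral_calculus_def by blast
  have Uc: "U \<in> carrier_mat n n" and Vc': "V \<in> carrier_mat m m"
    using U V unfolding unitary_mat_def by auto
  have "dim_row A = n" using AU Uc by simp
  moreover have "dim_row A = m" using AV Vc' by simp
  ultimately have mn: "m = n" by simp
  have Vc: "V \<in> carrier_mat n n" using Vc' mn by simp
  note UVa = mat_adjoint_carrier[OF Uc] mat_adjoint_carrier[OF Vc]
  have UU: "mat_adjoint U * U = 1\<^sub>m n" "U * mat_adjoint U = 1\<^sub>m n"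
    using U unitary_mat_right[OF U] unfolding unitary_mat_def by auto
  have VV: "mat_adjoint V * V = 1\<^sub>m n" "V * mat_adjoint V = 1\<^sub>m n"
    using V unitary_mat_right[OF V] mn unfolding unitary_mat_def by auto
  define W where "W = mat_adjoint V * U"
  have Wc: "W \<in> carrier_mat n n" using UVa Uc unfolding W_def by auto
  have Dc: "?D n x \<in> carrier_mat n n" for x by simp
  have left: "mat_adjoint V * (U * ?D n x * mat_adjoint U) * U = W * ?D n x" for x
  proof -
    have "mat_adjoint V * (U * ?D n x * mat_adjoint U) * U
      = mat_adjoint V * U * ?D n x * (mat_adjoint U * U)"
      by (rule mult_mat_regroup) (use UVa Uc Vc Dc[of x] in auto)
    then show ?thesis using Wc Dc[of x] unfolding UU W_def[symmetric] by simp
  qed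
  have right: "mat_adjoint V * (V * ?D n x * mat_adjoint V) * U = ?D n x * W" for x
  proof -
    have "mat_adjoint V * (V * ?D n x * mat_adjoint V) * U
      = (mat_adjoint V * V) * ?D n x * (mat_adjoint V * U)"
      by (rule mult_mat_regroup) (use UVa Uc Vc Dc[of x] in auto)
    then show ?thesis using Wc Dc[of x] unfolding VV W_def[symmetric] by simp
  qed
  have WD: "W * ?D n d = ?D n e * W"
    using left[of d] right[of e] AU AV mn by simp
  have WD': "W * ?D n (\<lambda>i. f (d i)) = ?D n (\<lambda>i. f (e i)) * W"
  proof (rule eq_matI)
    fix i j
    assume "i < dim_row (?D n (\<lambda>i. f (e i)) * W)" "j < dim_col (?D n (\<lambda>i. f (e i)) * W)"
    then have ij: "i < n" "j < n" using Wc by (auto simp: mat_diag_def)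
    have "(W * ?D n d) $$ (i, j) = (?D n e * W) $$ (i, j)" using WD by simp
    then have "W $$ (i, j) * complex_of_real (d j) = complex_of_real (e i) * W $$ (i, j)"
      using ij by (simp add: mat_diag_mult_left[OF Wc] mat_diag_mult_right[OF Wc])
    then have "W $$ (i, j) = 0 \<or> d j = e i" by auto
    then show "(W * ?D n (\<lambda>i. f (d i))) $$ (i, j) = (?D n (\<lambda>i. f (e i)) * W) $$ (i, j)"
      using ij by (auto simp: mat_diag_mult_left[OF Wc] mat_diag_mult_right[OF Wc])
  qed (use Wc in \<open>auto simp: mat_diag_def\<close>)
  have undo: "V * (mat_adjoint V * X * U) * mat_adjoint U = X" if X: "X \<in> carrier_mat n n" for X
  proof -
    have "V * (mat_adjoint V * X * U) * mat_adjoint U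
      = (V * mat_adjoint V) * X * (U * mat_adjoint U)"
      by (rule mult_mat_regroup) (use UVa Uc Vc X in auto)
    then show ?thesis using X unfolding UU VV by simp
  qed
  have Bc: "B \<in> carrier_mat n n" using B Uc UVa by auto
  have Cc: "C \<in> carrier_mat n n" using C Vc UVa mn by auto
  have "mat_adjoint V * B * U = mat_adjoint V * C * U"
    using left[of "\<lambda>i. f (d i)"] right[of "\<lambda>i. f (e i)"] WD' B C mn by simp
  then have "V * (mat_adjoint V * B * U) * mat_adjoint U = V * (mat_adjoint V * C * U) * mat_adjoint U"
    by (rule arg_cong)
  then show "B = C" unfolding undo[OF Bc] undo[OF Cc] .
qed

lemma mat_fun_diagonalization:
  assumes "unitary_mat n U"
  shows "mat_fun f (U * mat_diag n (\<lambda>i. complex_of_real (d i)) * mat_adjoint U)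
    = U * mat_diag n (\<lambda>i. complex_of_real (f (d i))) * mat_adjoint U"
  unfolding mat_fun_def
proof (rule the_equality)
  show *: "spectral_calculus f (U * mat_diag n (\<lambda>i. complex_of_real (d i)) * mat_adjoint U)
    (U * mat_diag n (\<lambda>i. complex_of_real (f (d i))) * mat_adjoint U)"
    using assms unfolding spectral_calculus_def by blast
  show "B = U * mat_diag n (\<lambda>i. complex_of_real (f (d i))) * mat_adjoint U"
    if "spectral_calculus f (U * mat_diag n (\<lambda>i. complex_of_real (d i)) * mat_adjoint U) B" for B
    using spectral_calculus_unique[OF that *] .
qed

lemma geom_mean_inverse:
  assumes "unitary_mat n U"
    and \<rho>: "\<rho> = U * mat_diag n (\<lambda>i. complex_of_real (d i)) * mat_adjoint U"
  shows "geom_mean (mat_pow \<rho> (-1)) \<sigma> =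
    mat_pow \<rho> (-1/2) * mat_pow (mat_pow \<rho> (1/2) * \<sigma> * mat_pow \<rho> (1/2)) (1/2) * mat_pow \<rho> (-1/2)"
proof -
  have "(x powr (-1)) powr s = x powr (-s)" for x s :: real
    by (simp only: powr_powr mult_minus1)
  then have "mat_pow (mat_pow \<rho> (-1)) s = mat_pow \<rho> (-s)" if "s \<noteq> 0" for s
    using that unfolding mat_pow_def \<rho> mat_fun_diagonalization[OF assms(1)]
    by (simp only: if_False neg_equal_0_iff_equal one_neq_zero)
  from this[of "1/2"] this[of "-1/2"] show ?thesis unfolding geom_mean_def by simp
qed

end

theory Submission
  imports Defs "Jordan_Normal_Form.Spectral_Radius"
begin

text \<open>
  The idea is to measure both states in the eigenbasis of the geometric mean
  \<open>G = \<rho>\<^sup>-\<^sup>1 # \<sigma>\<close> and to compare the resulting classical distributions.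

  Let \<open>G = \<Sum>\<^sub>i g\<^sub>i |u\<^sub>i\<rangle>\<langle>u\<^sub>i|\<close> with \<open>g\<^sub>i \<ge> 0\<close>, and put \<open>p\<^sub>i = \<langle>u\<^sub>i|\<rho>|u\<^sub>i\<rangle>\<close>. Then
  \<open>\<Sum>\<^sub>i p\<^sub>i = 1\<close>, and the fidelity is \<open>\<Sum>\<^sub>i p\<^sub>i g\<^sub>i powr (2t)\<close>. Since \<open>0 \<le> 2t \<le> 2\<close>, the number
  \<open>g\<^sub>i powr (2t)\<close> is at least \<open>min 1 (g\<^sub>i\<^sup>2)\<close>, whence
  \<open>1 - F \<le> \<Sum>\<^sub>i max 0 (p\<^sub>i - g\<^sub>i\<^sup>2 p\<^sub>i)\<close>.
  The defining property of the geometric mean is the Riccati equation \<open>G \<rho> G = \<sigma>\<close>; for singular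
  states it becomes \<open>G \<rho> G = P \<sigma> P\<close> with \<open>P\<close> the projection onto the support of \<open>\<rho>\<close>
  (\<open>geom_mean_sandwich\<close>). Hence \<open>g\<^sub>i\<^sup>2 p\<^sub>i = \<langle>u\<^sub>i|P \<sigma> P|u\<^sub>i\<rangle>\<close>, and since \<open>\<rho> = P \<rho> P\<close>, the
  difference \<open>p\<^sub>i - g\<^sub>i\<^sup>2 p\<^sub>i\<close> is the \<open>i\<close>-th diagonal entry of \<open>P (\<rho> - \<sigma>) P\<close> in the basis \<open>u\<close>.

  What remains is a fact about a traceless Hermitian matrix \<open>H\<close>: compressing it by a projection and
  then summing the positive parts of the diagonal in any orthonormal basis gives at most the sum of
  the positive eigenvalues of \<open>H\<close>, which is half of its trace norm
  (\<open>sum_pos_diag_compression_le_trace_norm\<close>).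

  Both steps rest on the unitary diagonalization of Hermitian matrices
  (\<open>hermitian_diagonalization\<close>).
\<close>

section \<open>Adjoints, traces and diagonal entries\<close>

lemma index_mat_adjoint [simp]:
  "i < dim_col A \<Longrightarrow> j < dim_row A \<Longrightarrow> mat_adjoint A $$ (i, j) = cnj (A $$ (j, i))"
  "dim_row (mat_adjoint A) = dim_col A"
  "dim_col (mat_adjoint A) = dim_row (A :: complex mat)"
  unfolding mat_adjoint_def by (auto simp: mat_of_rows_def)

lemma mat_adjoint_in_carrier [simp]:
  "(A :: complex mat) \<in> carrier_mat n m \<Longrightarrow> mat_adjoint A \<in> carrier_mat m n"
  unfolding mat_adjoint_def by auto

lemma mult_square_mat_carrier [simp]:
  "A \<in> carrier_mat n n \<Longrightarrow> B \<in> carrier_mat n n \<Longrightarrow> A * B \<in> carrier_mat n n"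
  by simp

lemma mat_adjoint_adjoint [simp]: "mat_adjoint (mat_adjoint A) = (A :: complex mat)"
  by (rule eq_matI) auto

lemma mat_adjoint_mult:
  fixes A B :: "complex mat"
  assumes "A \<in> carrier_mat n m" "B \<in> carrier_mat m k"
  shows "mat_adjoint (A * B) = mat_adjoint B * mat_adjoint A"
  by (rule eq_matI) (use assms in \<open>auto simp: scalar_prod_def mult.commute\<close>)

lemma mat_adjoint_minus:
  fixes A B :: "complex mat"
  assumes "A \<in> carrier_mat n m" "B \<in> carrier_mat n m"
  shows "mat_adjoint (A - B) = mat_adjoint A - mat_adjoint B"
  by (rule eq_matI) (use assms in auto)

abbreviation real_diag :: "nat \<Rightarrow> (nat \<Rightarrow> real) \<Rightarrow> complex mat" where
  "real_diag n d \<equiv> mat_diag n (\<lambda>i. complex_of_real (d i))"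

lemma mat_adjoint_real_diag [simp]: "mat_adjoint (real_diag n d) = real_diag n d"
  by (rule eq_matI) (auto simp: mat_diag_def)

lemma mult_mat_cancel_left:
  fixes A B C :: "complex mat"
  assumes "A \<in> carrier_mat n n" "B \<in> carrier_mat n n" "C \<in> carrier_mat n n" "A * B = 1\<^sub>m n"
  shows "A * (B * C) = C"
  using assms by (metis assoc_mult_mat left_mult_one_mat)

lemma mat_trace_mult_commute:
  fixes A B :: "complex mat"
  assumes "A \<in> carrier_mat n n" "B \<in> carrier_mat n n"
  shows "mat_trace (A * B) = mat_trace (B * A)"
proof -
  have "mat_trace (A * B) = (\<Sum>i<n. \<Sum>k<n. A $$ (i, k) * B $$ (k, i))"
    unfolding mat_trace_def
    by (rule sum.cong) (use assms in \<open>auto simp: scalar_prod_def lessThan_atLeast0\<close>)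
  also have "\<dots> = (\<Sum>k<n. \<Sum>i<n. B $$ (k, i) * A $$ (i, k))"
    by (subst sum.swap) (simp add: mult.commute)
  also have "\<dots> = mat_trace (B * A)"
    unfolding mat_trace_def
    by (rule sum.cong[symmetric]) (use assms in \<open>auto simp: scalar_prod_def lessThan_atLeast0\<close>)
  finally show ?thesis .
qed

text \<open>
  The diagonal of \<open>Y D Y\<^sup>*\<close> is the image of the entries of \<open>D\<close> under the nonnegative matrix
  \<open>|Y\<^sub>i\<^sub>k|\<^sup>2\<close>. Both the nonnegativity of the eigenvalues of the geometric mean and
  the comparison with the trace norm come from this formula.
\<close>

lemma diag_entry_congruence:
  assumes "Y \<in> carrier_mat m n" "i < m"
  shows "(Y * real_diag n d * mat_adjoint Y) $$ (i, i) = of_real (\<Sum>k<n. d k * (cmod (Y $$ (i, k)))\<^sup>2)"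
proof -
  have "(Y * real_diag n d * mat_adjoint Y) $$ (i, i)
    = (\<Sum>k<n. Y $$ (i, k) * of_real (d k) * cnj (Y $$ (i, k)))"
    using assms by (simp add: mat_diag_mult_right[OF assms(1)] scalar_prod_def lessThan_atLeast0)
  also have "\<dots> = of_real (\<Sum>k<n. d k * (cmod (Y $$ (i, k)))\<^sup>2)"
    unfolding of_real_sum
    by (rule sum.cong) (auto simp: complex_norm_square mult_ac simp del: of_real_power)
  finally show ?thesis .
qed

lemma diag_entry_mult_adjoint:
  assumes "Y \<in> carrier_mat m n" "i < m"
  shows "(Y * mat_adjoint Y) $$ (i, i) = of_real (\<Sum>k<n. (cmod (Y $$ (i, k)))\<^sup>2)"
  using diag_entry_congruence[OF assms, of "\<lambda>_. 1"] assms by simp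

lemma adjoint_mult_eq_0_imp_eq_0:
  fixes Y :: "complex mat"
  assumes Y: "Y \<in> carrier_mat n m" and 0: "mat_adjoint Y * Y = 0\<^sub>m m m"
  shows "Y = 0\<^sub>m n m"
proof (rule eq_matI)
  fix i j assume "i < dim_row (0\<^sub>m n m :: complex mat)" "j < dim_col (0\<^sub>m n m :: complex mat)"
  then have i: "i < n" and j: "j < m" by auto
  have "(\<Sum>k<n. (cmod (mat_adjoint Y $$ (j, k)))\<^sup>2) = 0"
    using diag_entry_mult_adjoint[OF mat_adjoint_in_carrier[OF Y] j] 0 j
    by (simp del: of_real_sum of_real_power)
  then have "\<forall>k<n. (cmod (mat_adjoint Y $$ (j, k)))\<^sup>2 = 0"
    by (subst (asm) sum_nonneg_eq_0_iff) auto
  then show "Y $$ (i, j) = 0\<^sub>m n m $$ (i, j)" using i j Y by auto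
qed (use Y in auto)

text \<open>
  The diagonal entries of \<open>X\<^sup>* A X\<close> are the values of the quadratic form of \<open>A\<close> at the columns
  of \<open>X\<close>.
\<close>

lemma psd_mat_diag_entry_nonneg:
  assumes A: "psd_mat n A" and X: "X \<in> carrier_mat n m" and j: "j < m"
  shows "0 \<le> (mat_adjoint X * A * X) $$ (j, j)"
proof -
  have Ac: "A \<in> carrier_mat n n" using A unfolding psd_mat_def by auto
  have "(mat_adjoint X * A * X) $$ (j, j) = (mat_adjoint X * (A * X)) $$ (j, j)"
    using Ac X by (simp add: assoc_mult_mat[of _ m n _ n _ m])
  also have "\<dots> = row (mat_adjoint X) j \<bullet> col (A * X) j"
    using Ac X j by simp
  also have "row (mat_adjoint X) j = conjugate (col X j)"
    using X j unfolding mat_adjoint_def by simp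
  also have "col (A * X) j = A *\<^sub>v col X j"
    by (rule col_mult2[OF Ac X j])
  also have "conjugate (col X j) \<bullet> (A *\<^sub>v col X j) = (A *\<^sub>v col X j) \<bullet>c col X j"
    by (rule comm_scalar_prod[of _ n]) (use Ac X in auto)
  also have "0 \<le> \<dots>" using A X j unfolding psd_mat_def by auto
  finally show ?thesis .
qed

section \<open>The spectral theorem for Hermitian matrices\<close>

lemma unitary_matD:
  assumes "unitary_mat n U"
  shows "U \<in> carrier_mat n n" "mat_adjoint U \<in> carrier_mat n n"
    "mat_adjoint U * U = 1\<^sub>m n" "U * mat_adjoint U = 1\<^sub>m n"
  using assms unitary_mat_right[OF assms] unfolding unitary_mat_def by auto

lemma unitary_mat_mult:
  assumes U: "unitary_mat n U" and V: "unitary_mat n V"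
  shows "unitary_mat n (U * V)"
proof -
  note [simp] = unitary_matD[OF U] unitary_matD[OF V]
  have "mat_adjoint (U * V) * (U * V) = mat_adjoint V * (mat_adjoint U * (U * V))"
    by (simp add: mat_adjoint_mult[of _ n n _ n] assoc_mult_mat[of _ n n _ n _ n])
  also have "mat_adjoint U * (U * V) = V"
    by (rule mult_mat_cancel_left[of _ n]) auto
  finally show ?thesis unfolding unitary_mat_def by simp
qed

text \<open>
  Complete \<open>v\<close> to a basis and orthogonalize; the Gram-Schmidt process keeps the first vector. It does
  not normalize, so the columns are divided by their norms afterwards, which is why only a multiple
  of \<open>v\<close> is obtained.
\<close>

lemma exists_unitary_first_col:
  fixes v :: "complex vec"
  assumes v: "v \<in> carrier_vec n" and v0: "v \<noteq> 0\<^sub>v n" and n: "n \<noteq> 0"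
  obtains W c where "unitary_mat n W" "col W 0 = c \<cdot>\<^sub>v v"
proof -
  interpret cof_vec_space n "TYPE(complex)" .
  define b where "b = basis_completion v"
  define ws where "ws = gram_schmidt n b"
  note bc = basis_completion[OF v v0, folded b_def]
  obtain vs where bv: "b = v # vs" using bc(6,7) n by (cases b) auto
  have ws: "set ws \<subseteq> carrier_vec n" "corthogonal ws" "length ws = n"
    using gram_schmidt_result[OF bc(2) bc(4) bc(5) refl, folded ws_def] bc(6) by auto
  have hd: "hd ws = v" using gram_schmidt_hd[OF v, of vs] unfolding ws_def bv .
  have ws0: "ws ! 0 = v" using hd ws(3) n by (cases ws) auto
  have wsc: "ws ! i \<in> carrier_vec n" if "i < n" for i using ws that by auto
  define r where "r i = inverse (sqrt (Re (ws ! i \<bullet>c ws ! i)))" for i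
  define W where "W = mat n n (\<lambda>(i, j). of_real (r j) * ws ! j $ i)"
  have W: "W \<in> carrier_mat n n" unfolding W_def by simp
  have "(mat_adjoint W * W) $$ (i, j) = 1\<^sub>m n $$ (i, j)" if ij: "i < n" "j < n" for i j
  proof -
    have "(mat_adjoint W * W) $$ (i, j) = of_real (r i * r j) * (ws ! j \<bullet>c ws ! i)"
      using W ij wsc[OF ij(1)] wsc[OF ij(2)] by (simp add: scalar_prod_def W_def sum_distrib_left mult_ac)
    also have "\<dots> = 1\<^sub>m n $$ (i, j)"
    proof (cases "i = j")
      case True
      have "0 < ws ! i \<bullet>c ws ! i"
        using corthogonalD[OF ws(2), of i i] ws(3) ij conjugate_square_ge_0_vec[of "ws ! i"]
        by (metis order_le_neq_trans)
      then have *: "0 < Re (ws ! i \<bullet>c ws ! i)" "ws ! i \<bullet>c ws ! i = of_real (Re (ws ! i \<bullet>c ws ! i))"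
        by (auto simp: less_complex_def complex_eq_iff)
      have "r i * r i * Re (ws ! i \<bullet>c ws ! i) = 1"
        using *(1) unfolding r_def by (simp add: field_simps)
      then have "of_real (r i * r i) * (ws ! i \<bullet>c ws ! i) = 1"
        by (metis *(2) of_real_1 of_real_mult)
      then show ?thesis using True ij by simp
    next
      case False
      then show ?thesis using corthogonalD[OF ws(2), of j i] ws(3) ij by auto
    qed
    finally show ?thesis .
  qed
  then have "mat_adjoint W * W = 1\<^sub>m n"
    by (intro eq_matI) (use W in auto)
  then have 1: "unitary_mat n W" unfolding unitary_mat_def using W by simp
  have 2: "col W 0 = of_real (r 0) \<cdot>\<^sub>v v"
    using n v ws0 by (intro eq_vecI) (auto simp: W_def)
  show thesis using that[OF 1 2] .
qed

text \<open>
  By induction on the dimension: in an orthonormal basis that starts with an eigenvector, the first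
  column of a Hermitian matrix is a multiple of the first unit vector, hence so is the first row, and
  the remaining block is again Hermitian.
\<close>

theorem hermitian_diagonalization:
  assumes "A \<in> carrier_mat n n" "mat_adjoint A = A"
  obtains U d where "unitary_mat n U" "A = U * real_diag n d * mat_adjoint U"
  using assms
proof (induction n arbitrary: A thesis)
  case 0
  show ?case
    by (rule "0.prems"(1)[of "1\<^sub>m 0" "\<lambda>_. 0"]) (use "0.prems" in \<open>auto simp: unitary_mat_def\<close>)
next
  case (Suc n)
  let ?m = "Suc n"
  note A = Suc.prems(2) and herm = Suc.prems(3)
  obtain e v where ev: "eigenvector A v e"
    using spectrum_non_empty[OF A] unfolding spectrum_def eigenvalue_def by auto
  then have v: "v \<in> carrier_vec ?m" "v \<noteq> 0\<^sub>v ?m" "A *\<^sub>v v = e \<cdot>\<^sub>v v"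
    using A unfolding eigenvector_def by auto
  obtain W c where W: "unitary_mat ?m W" and colW: "col W 0 = c \<cdot>\<^sub>v v"
    using exists_unitary_first_col[OF v(1,2)] by auto
  note Wc [simp] = unitary_matD[OF W]
  define B where "B = mat_adjoint W * A * W"
  have Bc [simp]: "B \<in> carrier_mat ?m ?m" unfolding B_def using A by simp
  note [simp] = carrier_matD[OF Bc]
  have Bherm: "mat_adjoint B = B"
    unfolding B_def using A herm
    by (simp add: mat_adjoint_mult[of _ ?m ?m _ ?m] assoc_mult_mat[of _ ?m ?m _ ?m _ ?m])
  have B0: "B $$ (i, 0) = (if i = 0 then e else 0)" if i: "i < ?m" for i
  proof -
    have "A *\<^sub>v col W 0 = e \<cdot>\<^sub>v col W 0"
      unfolding colW using v A by (simp add: mult_mat_vec smult_smult_assoc mult.commute)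
    then have c: "col (A * W) 0 = e \<cdot>\<^sub>v col W 0"
      using col_mult2[OF A Wc(1), of 0] by simp
    have "B $$ (i, 0) = row (mat_adjoint W) i \<bullet> col (A * W) 0"
      unfolding B_def using A i carrier_matD[OF Wc(1)]
      by (simp add: assoc_mult_mat[of _ ?m ?m _ ?m _ ?m] del: col_mult2)
    also have "\<dots> = e * (row (mat_adjoint W) i \<bullet> col W 0)"
      unfolding c by (rule scalar_prod_smult_distrib[of _ ?m])
        (use carrier_matD[OF Wc(1)] in \<open>auto intro!: carrier_vecI\<close>)
    also have "row (mat_adjoint W) i \<bullet> col W 0 = (mat_adjoint W * W) $$ (i, 0)"
      using i Wc(1) by (simp del: Wc)
    finally show ?thesis using i by simp
  qed
  have B0': "B $$ (0, i) = (if i = 0 then e else 0)" if i: "i < ?m" for i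
    using B0[OF i] arg_cong[OF Bherm, of "\<lambda>M. M $$ (0, i)"] arg_cong[OF Bherm, of "\<lambda>M. M $$ (i, 0)"] i
    by (auto split: if_splits)
  have e: "of_real (Re e) = e"
    using arg_cong[OF Bherm, of "\<lambda>M. M $$ (0, 0)"] B0[of 0]
    by (auto simp: complex_eq_iff)
  define C where "C = mat n n (\<lambda>(i, j). B $$ (Suc i, Suc j))"
  have "mat_adjoint C = C"
  proof (rule eq_matI)
    fix i j assume "i < dim_row C" "j < dim_col C"
    then show "mat_adjoint C $$ (i, j) = C $$ (i, j)"
      using arg_cong[OF Bherm, of "\<lambda>M. M $$ (Suc i, Suc j)"] by (simp add: C_def)
  qed (auto simp: C_def)
  moreover have Cc: "C \<in> carrier_mat n n" by (simp add: C_def)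
  ultimately obtain U d where U: "unitary_mat n U" and C: "C = U * real_diag n d * mat_adjoint U"
    using Suc.IH by blast
  note Uc [simp] = unitary_matD[OF U]
  \<comment> \<open>The direct sum of a scalar and a matrix.\<close>
  define blk where "blk a X = four_block_mat (mat 1 1 (\<lambda>_. a)) (0\<^sub>m 1 n) (0\<^sub>m n 1) X"
    for a :: complex and X
  have blk_c [simp]: "blk a X \<in> carrier_mat ?m ?m" if "X \<in> carrier_mat n n" for a X
    unfolding blk_def using that by auto
  have blk_mult: "blk a X * blk b Y = blk (a * b) (X * Y)"
    if "X \<in> carrier_mat n n" "Y \<in> carrier_mat n n" for a b X Y
  proof -
    have "mat 1 1 (\<lambda>_. a) * mat 1 1 (\<lambda>_. b) = mat 1 1 (\<lambda>_. a * b)"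
      by (rule eq_matI) (auto simp: scalar_prod_def)
    then show ?thesis
      unfolding blk_def
      by (subst mult_four_block_mat[of _ 1 1 _ n _ n _ _ 1 _ n]) (use that in auto)
  qed
  have blk_adj: "mat_adjoint (blk a X) = blk (cnj a) (mat_adjoint X)" if "X \<in> carrier_mat n n" for a X
    by (rule eq_matI) (use that in \<open>auto simp: blk_def\<close>)
  define d' where "d' i = (case i of 0 \<Rightarrow> Re e | Suc j \<Rightarrow> d j)" for i
  have diag: "blk e (real_diag n d) = real_diag ?m d'"
    by (rule eq_matI) (auto simp: blk_def mat_diag_def d'_def e split: nat.splits)
  have "blk 1 (1\<^sub>m n) = 1\<^sub>m ?m"
    by (rule eq_matI) (auto simp: blk_def)
  then have X: "unitary_mat ?m (blk 1 U)"
    unfolding unitary_mat_def by (simp add: blk_adj blk_mult)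
  have "B = blk e C"
    by (rule eq_matI) (auto simp: blk_def C_def B0 B0')
  also have "\<dots> = blk 1 U * real_diag ?m d' * mat_adjoint (blk 1 U)"
    unfolding C diag[symmetric] by (simp add: blk_adj blk_mult)
  finally have B: "B = blk 1 U * real_diag ?m d' * mat_adjoint (blk 1 U)" .
  have "A = W * B * mat_adjoint W"
  proof -
    have "W * B * mat_adjoint W = (W * mat_adjoint W) * A * (W * mat_adjoint W)"
      unfolding B_def by (rule mult_mat_regroup[of _ ?m]) (use A in auto)
    then show ?thesis using A by simp
  qed
  also have "\<dots> = (W * blk 1 U) * real_diag ?m d' * (mat_adjoint (blk 1 U) * mat_adjoint W)"
    unfolding B by (rule mult_mat_regroup[of _ ?m]) auto
  also have "mat_adjoint (blk 1 U) * mat_adjoint W = mat_adjoint (W * blk 1 U)"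
    by (simp add: mat_adjoint_mult[of _ ?m ?m _ ?m])
  finally show ?case
    using Suc.prems(1) unitary_mat_mult[OF W X] by blast
qed

section \<open>Functional calculus and traces in an eigenbasis\<close>

lemma unitary_conjugates_mult:
  assumes U: "unitary_mat n U" and B: "B \<in> carrier_mat n n" and C: "C \<in> carrier_mat n n"
  shows "(U * B * mat_adjoint U) * (U * C * mat_adjoint U) = U * (B * C) * mat_adjoint U"
proof -
  note [simp] = unitary_matD[OF U] B C
  have "mat_adjoint U * (U * Z) = Z" if "Z \<in> carrier_mat n n" for Z
    by (rule mult_mat_cancel_left[of _ n]) (use that in auto)
  then show ?thesis by (simp add: assoc_mult_mat[of _ n n _ n _ n])
qed

lemma mat_pow_diagonalization:
  assumes "unitary_mat n U"
  shows "mat_pow (U * real_diag n d * mat_adjoint U) s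
    = U * real_diag n (\<lambda>i. if s = 0 then 1 else d i powr s) * mat_adjoint U"
  unfolding mat_pow_def mat_fun_diagonalization[OF assms] ..

lemma unitary_conjugate_undo:
  assumes U: "unitary_mat n U" and B: "B \<in> carrier_mat n n"
  shows "mat_adjoint U * (U * B * mat_adjoint U) * U = B"
proof -
  note [simp] = unitary_matD[OF U]
  have "mat_adjoint U * (U * B * mat_adjoint U) * U = (mat_adjoint U * U) * B * (mat_adjoint U * U)"
    by (rule mult_mat_regroup[of _ n]) (use B in auto)
  then show ?thesis using B by simp
qed

lemma mat_trace_unitary_conjugate:
  assumes U: "unitary_mat n U" and A: "A \<in> carrier_mat n n"
  shows "mat_trace (mat_adjoint U * A * U) = mat_trace A"
proof -
  note [simp] = unitary_matD[OF U]
  have "mat_trace (mat_adjoint U * A * U) = mat_trace (U * (mat_adjoint U * A))"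
    by (rule mat_trace_mult_commute[of _ n]) (use A in auto)
  also have "U * (mat_adjoint U * A) = A"
    by (rule mult_mat_cancel_left[of _ n]) (use A in auto)
  finally show ?thesis .
qed

lemma mat_trace_real_diag: "mat_trace (real_diag n d) = of_real (\<Sum>i<n. d i)"
  unfolding mat_trace_def by (simp add: mat_diag_def)

lemma mat_trace_diagonalization:
  assumes U: "unitary_mat n U"
  shows "mat_trace (U * real_diag n d * mat_adjoint U) = of_real (\<Sum>i<n. d i)"
proof -
  note [simp] = unitary_matD[OF U]
  show ?thesis
    using mat_trace_unitary_conjugate[OF U, of "U * real_diag n d * mat_adjoint U"]
    by (simp add: unitary_conjugate_undo[OF U] mat_trace_real_diag del: of_real_sum)
qed

lemma mat_trace_mult_diagonalization:
  assumes U: "unitary_mat n U" and A: "A \<in> carrier_mat n n"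
  shows "mat_trace (A * (U * real_diag n h * mat_adjoint U))
    = (\<Sum>i<n. (mat_adjoint U * A * U) $$ (i, i) * of_real (h i))"
proof -
  note [simp] = unitary_matD[OF U] A
  have M: "mat_adjoint U * A * U \<in> carrier_mat n n" by simp
  have "A * (U * real_diag n h * mat_adjoint U) = (A * U * real_diag n h) * mat_adjoint U"
    by (simp add: assoc_mult_mat[of _ n n _ n _ n])
  also have "mat_trace \<dots> = mat_trace (mat_adjoint U * (A * U * real_diag n h))"
    by (rule mat_trace_mult_commute[of _ n]) auto
  also have "mat_adjoint U * (A * U * real_diag n h) = (mat_adjoint U * A * U) * real_diag n h"
    by (simp add: assoc_mult_mat[of _ n n _ n _ n])
  also have "mat_trace \<dots> = (\<Sum>i<n. (mat_adjoint U * A * U) $$ (i, i) * of_real (h i))"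
    unfolding mat_diag_mult_right[OF M] mat_trace_def by simp
  finally show ?thesis .
qed

lemma diagonalization_hermitian:
  assumes U: "unitary_mat n U"
  shows "mat_adjoint (U * real_diag n d * mat_adjoint U) = U * real_diag n d * mat_adjoint U"
proof -
  note [simp] = unitary_matD[OF U]
  show ?thesis
    by (simp add: mat_adjoint_mult[of _ n n _ n] assoc_mult_mat[of _ n n _ n _ n])
qed

text \<open>
  With \<open>V\<close> an eigenbasis of \<open>R A R\<close>, its eigenvalues are the diagonal entries of
  \<open>(R V)\<^sup>* A (R V)\<close>, where positivity of \<open>A\<close> applies.
\<close>

lemma psd_mat_congruence_diagonalization:
  assumes A: "psd_mat n A" and R: "R \<in> carrier_mat n n" "mat_adjoint R = R"
  obtains V k where "unitary_mat n V" "R * A * R = V * real_diag n k * mat_adjoint V"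
    "\<And>i. i < n \<Longrightarrow> 0 \<le> k i"
proof -
  note [simp] = R
  have [simp]: "A \<in> carrier_mat n n" and Ah: "mat_adjoint A = A"
    using A unfolding psd_mat_def by auto
  have "mat_adjoint (R * A * R) = R * A * R"
    by (simp add: mat_adjoint_mult[of _ n n _ n] assoc_mult_mat[of _ n n _ n _ n] Ah)
  then obtain V k where V: "unitary_mat n V" and eq: "R * A * R = V * real_diag n k * mat_adjoint V"
    using hermitian_diagonalization[of "R * A * R" n] by auto
  note [simp] = unitary_matD[OF V]
  have "0 \<le> k i" if i: "i < n" for i
  proof -
    have "mat_adjoint (R * V) * A * (R * V) = mat_adjoint V * (R * A * R) * V"
      by (simp add: mat_adjoint_mult[of _ n n _ n] assoc_mult_mat[of _ n n _ n _ n])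
    also have "\<dots> = real_diag n k"
      unfolding eq by (rule unitary_conjugate_undo[OF V]) simp
    finally have "(mat_adjoint (R * V) * A * (R * V)) $$ (i, i) = of_real (k i)"
      using i by (simp add: mat_diag_def)
    then show ?thesis
      using psd_mat_diag_entry_nonneg[OF A, of "R * V" n i] i by (simp add: less_eq_complex_def)
  qed
  then show thesis using that V eq by blast
qed

lemma psd_mat_diagonalization:
  assumes A: "psd_mat n A"
  obtains V k where "unitary_mat n V" "A = V * real_diag n k * mat_adjoint V"
    "\<And>i. i < n \<Longrightarrow> 0 \<le> k i"
proof -
  have "A \<in> carrier_mat n n" using A unfolding psd_mat_def by auto
  moreover have "mat_adjoint (1\<^sub>m n) = (1\<^sub>m n :: complex mat)" by (rule eq_matI) auto
  ultimately show thesis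
    using psd_mat_congruence_diagonalization[OF A, of "1\<^sub>m n"] that by auto
qed

section \<open>The trace norm of a traceless Hermitian matrix\<close>

lemma trace_norm_diagonalization:
  assumes V: "unitary_mat n V"
  shows "trace_norm (V * real_diag n l * mat_adjoint V) = (\<Sum>j<n. \<bar>l j\<bar>)"
proof -
  let ?Y = "V * real_diag n l * mat_adjoint V"
  have sq: "mat_adjoint ?Y * ?Y = V * real_diag n (\<lambda>j. l j * l j) * mat_adjoint V"
    unfolding diagonalization_hermitian[OF V] by (simp add: unitary_conjugates_mult[OF V])
  show ?thesis
    unfolding trace_norm_def sq mat_pow_diagonalization[OF V] mat_trace_diagonalization[OF V]
    by (simp add: powr_half_sqrt)
qed

text \<open>
  For a projection, \<open>M = M M\<^sup>*\<close> makes each diagonal entry the squared norm of its row. This sum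
  contains the square of the entry itself, so the entry is at least its own square, and hence at most
  one.
\<close>

lemma projection_diag_entry_le_1:
  assumes M: "M \<in> carrier_mat n n" "mat_adjoint M = M" "M * M = M" and j: "j < n"
  shows "M $$ (j, j) = of_real (\<Sum>k<n. (cmod (M $$ (j, k)))\<^sup>2)"
    and "(\<Sum>k<n. (cmod (M $$ (j, k)))\<^sup>2) \<le> 1"
proof -
  let ?s = "\<Sum>k<n. (cmod (M $$ (j, k)))\<^sup>2"
  show s: "M $$ (j, j) = of_real ?s"
    using diag_entry_mult_adjoint[OF M(1) j] unfolding M(2,3) .
  have s0: "0 \<le> ?s" by (rule sum_nonneg) simp
  have "?s\<^sup>2 = (cmod (M $$ (j, j)))\<^sup>2" using s s0 by (simp del: of_real_sum)
  also have "\<dots> \<le> ?s"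
    by (rule member_le_sum[where f = "\<lambda>k. (cmod (M $$ (j, k)))\<^sup>2"]) (use j in auto)
  finally have "?s * ?s \<le> ?s * 1" by (simp add: power2_eq_square)
  then show "?s \<le> 1" using s0 by (metis mult_le_cancel_left_pos order_le_less zero_le_one)
qed

text \<open>
  In an eigenbasis \<open>V\<close> of \<open>H\<close>, with eigenvalues \<open>l\<^sub>j\<close>, the diagonal entries in question are
  \<open>\<Sum>\<^sub>j l\<^sub>j |W\<^sub>i\<^sub>j|\<^sup>2\<close> for \<open>W = U\<^sup>* P V\<close>. The columns of \<open>W\<close> have norm at most one, because
  \<open>W\<^sup>* W = V\<^sup>* P V\<close> is a projection; so the positive parts add up to at most the sum of the positive
  \<open>l\<^sub>j\<close>. As the \<open>l\<^sub>j\<close> sum to zero, their positive parts make up half of their absolute values.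
\<close>

lemma sum_pos_diag_compression_le_trace_norm:
  assumes H: "H \<in> carrier_mat n n" "mat_adjoint H = H" "mat_trace H = 0"
    and P: "P \<in> carrier_mat n n" "mat_adjoint P = P" "P * P = P"
    and U: "unitary_mat n U"
  shows "(\<Sum>i<n. max 0 (Re ((mat_adjoint U * (P * H * P) * U) $$ (i, i)))) \<le> 1/2 * trace_norm H"
proof -
  obtain V l where V: "unitary_mat n V" and eq: "H = V * real_diag n l * mat_adjoint V"
    using hermitian_diagonalization H by blast
  note [simp] = unitary_matD[OF U] unitary_matD[OF V] P(1)
  define W where "W = mat_adjoint U * P * V"
  have Wc [simp]: "W \<in> carrier_mat n n" unfolding W_def by simp
  have Wadj: "mat_adjoint W = mat_adjoint V * P * U"
    unfolding W_def
    by (simp add: mat_adjoint_mult[of _ n n _ n] assoc_mult_mat[of _ n n _ n _ n] P)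
  have WW: "mat_adjoint U * (P * H * P) * U = W * real_diag n l * mat_adjoint W"
    unfolding eq Wadj by (simp add: W_def assoc_mult_mat[of _ n n _ n _ n])
  have entry: "Re ((mat_adjoint U * (P * H * P) * U) $$ (i, i)) = (\<Sum>j<n. l j * (cmod (W $$ (i, j)))\<^sup>2)"
    if "i < n" for i
    unfolding WW diag_entry_congruence[OF Wc that] by simp
  have col: "(\<Sum>i<n. (cmod (W $$ (i, j)))\<^sup>2) \<le> 1" if j: "j < n" for j
  proof -
    define M where "M = mat_adjoint V * P * V"
    have Mc: "M \<in> carrier_mat n n" unfolding M_def by simp
    have cancel: "U * (mat_adjoint U * Z) = Z" "V * (mat_adjoint V * Z) = Z" "P * (P * Z) = P * Z"
      if Z: "Z \<in> carrier_mat n n" for Z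
      using Z mult_mat_cancel_left[of U n "mat_adjoint U"] mult_mat_cancel_left[of V n "mat_adjoint V"]
        assoc_mult_mat[OF P(1) P(1) Z] P(3) by auto
    have M1: "mat_adjoint M = M"
      unfolding M_def by (simp add: mat_adjoint_mult[of _ n n _ n] assoc_mult_mat[of _ n n _ n _ n] P)
    have M2: "M * M = M"
      unfolding M_def by (simp add: assoc_mult_mat[of _ n n _ n _ n] cancel)
    have "mat_adjoint W * W = M"
      unfolding Wadj M_def by (simp add: W_def assoc_mult_mat[of _ n n _ n _ n] cancel)
    then have "M $$ (j, j) = (mat_adjoint W * mat_adjoint (mat_adjoint W)) $$ (j, j)" by simp
    also have "\<dots> = of_real (\<Sum>i<n. (cmod (mat_adjoint W $$ (j, i)))\<^sup>2)"
      by (rule diag_entry_mult_adjoint) (use j in auto)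
    also have "(\<Sum>i<n. (cmod (mat_adjoint W $$ (j, i)))\<^sup>2) = (\<Sum>i<n. (cmod (W $$ (i, j)))\<^sup>2)"
      by (rule sum.cong) (use j carrier_matD[OF Wc] in auto)
    finally show ?thesis
      using projection_diag_entry_le_1[OF Mc M1 M2 j] of_real_eq_iff by metis
  qed
  have "(\<Sum>i<n. max 0 (Re ((mat_adjoint U * (P * H * P) * U) $$ (i, i))))
    \<le> (\<Sum>i<n. \<Sum>j<n. max 0 (l j) * (cmod (W $$ (i, j)))\<^sup>2)"
  proof (rule sum_mono)
    fix i assume "i \<in> {..<n}"
    then have i: "i < n" by simp
    have "(\<Sum>j<n. l j * (cmod (W $$ (i, j)))\<^sup>2) \<le> (\<Sum>j<n. max 0 (l j) * (cmod (W $$ (i, j)))\<^sup>2)"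
      by (intro sum_mono mult_right_mono) auto
    moreover have "0 \<le> (\<Sum>j<n. max 0 (l j) * (cmod (W $$ (i, j)))\<^sup>2)"
      by (intro sum_nonneg mult_nonneg_nonneg) auto
    ultimately show "max 0 (Re ((mat_adjoint U * (P * H * P) * U) $$ (i, i)))
      \<le> (\<Sum>j<n. max 0 (l j) * (cmod (W $$ (i, j)))\<^sup>2)"
      unfolding entry[OF i] by simp
  qed
  also have "\<dots> = (\<Sum>j<n. max 0 (l j) * (\<Sum>i<n. (cmod (W $$ (i, j)))\<^sup>2))"
    by (subst sum.swap) (simp add: sum_distrib_left)
  also have "\<dots> \<le> (\<Sum>j<n. max 0 (l j) * 1)"
    by (intro sum_mono mult_left_mono col) auto
  also have "\<dots> = (\<Sum>j<n. (l j + \<bar>l j\<bar>) / 2)"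
    by (rule sum.cong) auto
  also have "\<dots> = 1/2 * ((\<Sum>j<n. l j) + (\<Sum>j<n. \<bar>l j\<bar>))"
    by (simp add: sum.distrib flip: sum_divide_distrib)
  also have "(\<Sum>j<n. l j) = 0"
    using H(3) unfolding eq mat_trace_diagonalization[OF V] by (simp del: of_real_sum)
  finally show ?thesis unfolding eq trace_norm_diagonalization[OF V] by simp
qed

section \<open>The geometric mean and the spectral fidelity\<close>

text \<open>
  Take for \<open>P\<close> the projection onto the support of \<open>\<rho>\<close>. Put \<open>R = \<rho>\<^sup>1\<^sup>/\<^sup>2\<close>, let \<open>S\<close> be the inverse
  of \<open>R\<close> on the support, and \<open>K = (R \<sigma> R)\<^sup>1\<^sup>/\<^sup>2\<close>, so that \<open>G = S K S\<close>. Then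
  \<open>G \<rho> G = S K (S \<rho> S) K S = S K P K S = S K K S = (S R) \<sigma> (R S) = P \<sigma> P\<close>.
  The third equality needs that \<open>K\<close> vanishes on the kernel of \<open>\<rho>\<close>, where \<open>K\<^sup>2 = R \<sigma> R\<close> does. Besides
  this Riccati equation, \<open>G\<close> has nonnegative eigenvalues, being congruent to \<open>K\<close>.
\<close>

lemma geom_mean_sandwich:
  assumes \<rho>: "psd_mat n \<rho>" and \<sigma>: "psd_mat n \<sigma>"
  obtains P U g where "P \<in> carrier_mat n n" "mat_adjoint P = P" "P * P = P" "P * \<rho> * P = \<rho>"
    "unitary_mat n U"
    "geom_mean (mat_pow \<rho> (-1)) \<sigma> = U * real_diag n g * mat_adjoint U"
    "\<And>i. i < n \<Longrightarrow> 0 \<le> g i"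
    "(U * real_diag n g * mat_adjoint U) * \<rho> * (U * real_diag n g * mat_adjoint U) = P * \<sigma> * P"
proof -
  obtain X d where X: "unitary_mat n X" and \<rho>X: "\<rho> = X * real_diag n d * mat_adjoint X"
    and d: "\<And>i. i < n \<Longrightarrow> 0 \<le> d i"
    using psd_mat_diagonalization[OF \<rho>] by blast
  note [simp] = unitary_matD[OF X]
  define D where "D f = X * real_diag n f * mat_adjoint X" for f
  have Dc [simp]: "D f \<in> carrier_mat n n" for f unfolding D_def by simp
  have D_adj [simp]: "mat_adjoint (D f) = D f" for f
    unfolding D_def by (rule diagonalization_hermitian[OF X])
  have D_mult: "D f * D h = D (\<lambda>i. f i * h i)" for f h
    unfolding D_def by (simp add: unitary_conjugates_mult[OF X])
  have D_cong: "D f = D h" if "\<And>i. i < n \<Longrightarrow> f i = h i" for f h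
  proof -
    have "real_diag n f = real_diag n h" by (rule eq_matI) (auto simp: mat_diag_def that)
    then show ?thesis unfolding D_def by simp
  qed
  \<comment> \<open>\<open>P\<close> and \<open>Q\<close> project onto the support and the kernel of \<open>\<rho>\<close>.\<close>
  define P where "P = D (\<lambda>i. if d i = 0 then 0 else 1)"
  define Q where "Q = D (\<lambda>i. if d i = 0 then 1 else 0)"
  define R where "R = D (\<lambda>i. d i powr (1/2))"
  define S where "S = D (\<lambda>i. d i powr (-1/2))"
  have c [simp]: "P \<in> carrier_mat n n" "Q \<in> carrier_mat n n" "R \<in> carrier_mat n n" "S \<in> carrier_mat n n"
    and adj [simp]: "mat_adjoint P = P" "mat_adjoint Q = Q" "mat_adjoint R = R" "mat_adjoint S = S"
    unfolding P_def Q_def R_def S_def by auto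
  have PP: "P * P = P" and SR: "S * R = P" and RS: "R * S = P" and SRS: "S * \<rho> * S = P"
    and PR: "P * \<rho> * P = \<rho>" and RQ: "R * Q = D (\<lambda>_. 0)" and PQ: "P + Q = 1\<^sub>m n"
  proof -
    have \<rho>D: "\<rho> = D d" unfolding D_def \<rho>X ..
    have sq: "x powr (1/2) * x powr -(1/2) = 1" "x powr -(1/2) * x * x powr -(1/2) = 1"
      if "0 < x" for x :: real
      using that by (auto simp: powr_minus powr_half_sqrt field_simps)
    show "P * P = P" "P * \<rho> * P = \<rho>"
      unfolding P_def \<rho>D D_mult by (rule D_cong, simp)+
    show "S * R = P" "R * S = P" "S * \<rho> * S = P"
      unfolding P_def \<rho>D D_mult R_def S_def
      by (rule D_cong, use sq d in \<open>force simp: less_le mult.commute\<close>)+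
    show "R * Q = D (\<lambda>_. 0)"
      unfolding Q_def R_def D_mult by (rule D_cong) simp
    have "P + Q = X * (real_diag n (\<lambda>i. if d i = 0 then 0 else 1)
      + real_diag n (\<lambda>i. if d i = 0 then 1 else 0)) * mat_adjoint X"
      unfolding P_def Q_def D_def
      by (simp add: add_mult_distrib_mat[of _ n n _ _ n] mult_add_distrib_mat[of _ n n _ n])
    also have "real_diag n (\<lambda>i. if d i = 0 then 0 else 1) + real_diag n (\<lambda>i. if d i = 0 then 1 else 0)
      = (1\<^sub>m n :: complex mat)"
      by (rule eq_matI) (auto simp: mat_diag_def)
    finally show "P + Q = 1\<^sub>m n" by (simp add: right_mult_one_mat[of _ n n])
  qed
  have D0: "D (\<lambda>_. 0) = 0\<^sub>m n n"
  proof -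
    have "real_diag n (\<lambda>_. 0) = 0\<^sub>m n n" by (rule eq_matI) (auto simp: mat_diag_def)
    then show ?thesis unfolding D_def by (simp add: right_mult_zero_mat[of X n n]
          left_mult_zero_mat[of "mat_adjoint X" n n])
  qed
  obtain V k where V: "unitary_mat n V" and k: "R * \<sigma> * R = V * real_diag n k * mat_adjoint V"
    and k0: "\<And>i. i < n \<Longrightarrow> 0 \<le> k i"
    using psd_mat_congruence_diagonalization[OF \<sigma> c(3) adj(3)] by blast
  note [simp] = unitary_matD[OF V]
  have [simp]: "\<sigma> \<in> carrier_mat n n" "\<rho> \<in> carrier_mat n n" using \<rho> \<sigma> unfolding psd_mat_def by auto
  define K where "K = V * real_diag n (\<lambda>i. k i powr (1/2)) * mat_adjoint V"
  have Kc [simp]: "K \<in> carrier_mat n n" unfolding K_def by simp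
  have Kadj [simp]: "mat_adjoint K = K" unfolding K_def by (rule diagonalization_hermitian[OF V])
  have "real_diag n (\<lambda>i. k i powr (1/2) * k i powr (1/2)) = real_diag n k"
    by (rule eq_matI) (auto simp: mat_diag_def k0 powr_half_sqrt simp flip: of_real_mult)
  then have KK: "K * K = R * \<sigma> * R"
    unfolding K_def k by (simp add: unitary_conjugates_mult[OF V])
  have KQ: "K * Q = 0\<^sub>m n n"
  proof (rule adjoint_mult_eq_0_imp_eq_0)
    have "mat_adjoint (K * Q) * (K * Q) = Q * (K * K) * Q"
      by (simp add: mat_adjoint_mult[of _ n n _ n] assoc_mult_mat[of _ n n _ n _ n])
    also have "\<dots> = Q * R * \<sigma> * (R * Q)"
      unfolding KK by (simp add: assoc_mult_mat[of _ n n _ n _ n])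
    also have "\<dots> = 0\<^sub>m n n" unfolding RQ D0 by (rule right_mult_zero_mat) simp
    finally show "mat_adjoint (K * Q) * (K * Q) = 0\<^sub>m n n" .
  qed simp
  have KP: "K * P = K"
  proof -
    have "K = K * (P + Q)" unfolding PQ by (rule right_mult_one_mat[of _ n n, symmetric]) simp
    also have "\<dots> = K * P + K * Q" by (rule mult_add_distrib_mat[of _ n n _ n]) auto
    finally show ?thesis unfolding KQ by simp
  qed
  define G where "G = S * K * S"
  have Gc [simp]: "G \<in> carrier_mat n n" unfolding G_def by simp
  have "mat_pow \<rho> (1/2) = R" "mat_pow \<rho> (-1/2) = S"
    unfolding \<rho>X mat_pow_diagonalization[OF X] R_def S_def D_def by auto
  moreover have "mat_pow (R * \<sigma> * R) (1/2) = K"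
    unfolding k mat_pow_diagonalization[OF V] K_def by simp
  ultimately have GM: "geom_mean (mat_pow \<rho> (-1)) \<sigma> = G"
    unfolding geom_mean_inverse[OF X \<rho>X] G_def by (simp only:)
  have "mat_adjoint G = G"
    unfolding G_def by (simp add: mat_adjoint_mult[of _ n n _ n] assoc_mult_mat[of _ n n _ n _ n])
  then obtain U g where U: "unitary_mat n U" and g: "G = U * real_diag n g * mat_adjoint U"
    using hermitian_diagonalization[of G n] by auto
  note [simp] = unitary_matD[OF U]
  have g0: "0 \<le> g i" if i: "i < n" for i
  proof -
    define Y where "Y = mat_adjoint U * S * V"
    have Yc [simp]: "Y \<in> carrier_mat n n" unfolding Y_def by simp
    have "real_diag n g = mat_adjoint U * G * U"
      unfolding g by (rule unitary_conjugate_undo[OF U, symmetric]) simp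
    also have "\<dots> = Y * real_diag n (\<lambda>i. k i powr (1/2)) * mat_adjoint Y"
      unfolding G_def K_def Y_def
      by (simp add: mat_adjoint_mult[of _ n n _ n] assoc_mult_mat[of _ n n _ n _ n])
    finally have eq: "real_diag n g = Y * real_diag n (\<lambda>i. k i powr (1/2)) * mat_adjoint Y" .
    have "complex_of_real (g i) = real_diag n g $$ (i, i)"
      using i by (simp add: mat_diag_def)
    also have "\<dots> = of_real (\<Sum>j<n. k j powr (1/2) * (cmod (Y $$ (i, j)))\<^sup>2)"
      unfolding eq by (rule diag_entry_congruence[OF Yc i])
    finally have "g i = (\<Sum>j<n. k j powr (1/2) * (cmod (Y $$ (i, j)))\<^sup>2)"
      by (simp only: of_real_eq_iff)
    also have "0 \<le> \<dots>" by (intro sum_nonneg mult_nonneg_nonneg) auto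
    finally show ?thesis .
  qed
  have "G * \<rho> * G = S * (K * (S * \<rho> * S) * K) * S"
    unfolding G_def by (simp add: assoc_mult_mat[of _ n n _ n _ n])
  also have "\<dots> = S * (K * K) * S" unfolding SRS KP ..
  also have "\<dots> = (S * R) * \<sigma> * (R * S)"
    unfolding KK by (simp add: assoc_mult_mat[of _ n n _ n _ n])
  also have "\<dots> = P * \<sigma> * P" unfolding SR RS ..
  finally have sandwich: "G * \<rho> * G = P * \<sigma> * P" .
  show thesis
    by (rule that[OF c(1) adj(1) PP PR U GM[unfolded g] g0 sandwich[unfolded g]])
qed

theorem theorem6p1:
  fixes n :: nat and \<rho> \<sigma> :: "complex mat" and t :: real
  assumes "density_matrix n \<rho>" and "density_matrix n \<sigma>"
    and "0 \<le> t" and "t \<le> 1"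
  shows "1 - spectral_fidelity t \<rho> \<sigma> \<le> 1/2 * trace_norm (\<rho> - \<sigma>)"
proof -
  have psd: "psd_mat n \<rho>" "psd_mat n \<sigma>" and tr: "mat_trace \<rho> = 1" "mat_trace \<sigma> = 1"
    using assms(1,2) unfolding density_matrix_def by auto
  have [simp]: "\<rho> \<in> carrier_mat n n" "\<sigma> \<in> carrier_mat n n"
    and herm: "mat_adjoint \<rho> = \<rho>" "mat_adjoint \<sigma> = \<sigma>"
    using psd unfolding psd_mat_def by auto
  obtain P U g where P: "P \<in> carrier_mat n n" "mat_adjoint P = P" "P * P = P" and P\<rho>: "P * \<rho> * P = \<rho>"
    and U: "unitary_mat n U" and G: "geom_mean (mat_pow \<rho> (-1)) \<sigma> = U * real_diag n g * mat_adjoint U"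
    and g: "\<And>i. i < n \<Longrightarrow> 0 \<le> g i"
    and sandwich: "(U * real_diag n g * mat_adjoint U) * \<rho> * (U * real_diag n g * mat_adjoint U) = P * \<sigma> * P"
    using geom_mean_sandwich[OF psd] by blast
  note [simp] = P(1) unitary_matD[OF U]
  define p where "p i = Re ((mat_adjoint U * \<rho> * U) $$ (i, i))" for i
  define h where "h i = (if 2 * t = 0 then 1 else g i powr (2 * t))" for i
  have p0: "0 \<le> p i" if "i < n" for i
    using psd_mat_diag_entry_nonneg[OF psd(1), of U n i] that unfolding p_def
    by (simp add: less_eq_complex_def)
  have sum_p: "(\<Sum>i<n. p i) = 1"
  proof -
    have "(\<Sum>i<n. p i) = Re (mat_trace (mat_adjoint U * \<rho> * U))"
      unfolding p_def mat_trace_def using carrier_matD[OF unitary_matD(1)[OF U]] by simp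
    then show ?thesis by (simp add: mat_trace_unitary_conjugate[OF U] tr)
  qed
  have F: "spectral_fidelity t \<rho> \<sigma> = (\<Sum>i<n. p i * h i)"
    unfolding spectral_fidelity_def G mat_pow_diagonalization[OF U] p_def h_def
    by (subst mat_trace_mult_diagonalization[OF U]) auto
  have q: "Re ((mat_adjoint U * (P * \<sigma> * P) * U) $$ (i, i)) = (g i)\<^sup>2 * p i" if i: "i < n" for i
  proof -
    have M: "mat_adjoint U * \<rho> * U \<in> carrier_mat n n" by simp
    have cancel: "mat_adjoint U * (U * Z) = Z" if "Z \<in> carrier_mat n n" for Z
      by (rule mult_mat_cancel_left[of _ n]) (use that in auto)
    have "mat_adjoint U * (P * \<sigma> * P) * U
      = real_diag n g * (mat_adjoint U * \<rho> * U) * real_diag n g"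
      unfolding sandwich[symmetric]
      by (simp add: assoc_mult_mat[of _ n n _ n _ n] cancel right_mult_one_mat[of _ n n])
    then have "(mat_adjoint U * (P * \<sigma> * P) * U) $$ (i, i)
      = of_real (g i) * (mat_adjoint U * \<rho> * U) $$ (i, i) * of_real (g i)"
      using i by (simp add: mat_diag_mult_right[of _ n n] mat_diag_mult_left[OF M])
    then show ?thesis unfolding p_def by (simp add: power2_eq_square)
  qed
  have diff: "Re ((mat_adjoint U * (P * (\<rho> - \<sigma>) * P) * U) $$ (i, i)) = p i - (g i)\<^sup>2 * p i"
    if i: "i < n" for i
  proof -
    have "mat_adjoint U * (P * (\<rho> - \<sigma>) * P) * U
      = mat_adjoint U * (P * \<rho> * P) * U - mat_adjoint U * (P * \<sigma> * P) * U"
      by (simp add: mult_minus_distrib_mat[of _ n n _ n] minus_mult_distrib_mat[of _ n n _ _ n])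
    then show ?thesis
      using i carrier_matD[OF unitary_matD(1)[OF U]] q[OF i]
      unfolding P\<rho> p_def by simp
  qed
  \<comment> \<open>The exponent \<open>2 * t\<close> lies between \<open>0\<close> and \<open>2\<close>, so \<open>h i\<close> lies between \<open>1\<close> and \<open>(g i)\<^sup>2\<close>, in one order or the other.\<close>
  have h_ge: "min 1 ((g i)\<^sup>2) \<le> h i" if i: "i < n" for i
  proof (cases "t = 0 \<or> g i = 0")
    case False
    then have gp: "0 < g i" "t \<noteq> 0" using g[OF i] by auto
    show ?thesis
    proof (cases "g i \<le> 1")
      case True
      have "(g i)\<^sup>2 = g i powr 2" using gp by (simp add: powr_numeral)
      also have "\<dots> \<le> g i powr (2 * t)"
        by (rule powr_mono') (use gp True assms in auto)
      finally show ?thesis using gp unfolding h_def by simp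
    next
      case False
      then have "1 \<le> g i powr (2 * t)" using assms by (intro ge_one_powr_ge_zero) auto
      then show ?thesis using gp unfolding h_def by simp
    qed
  qed (auto simp: h_def)
  have "1 - spectral_fidelity t \<rho> \<sigma> = (\<Sum>i<n. p i - p i * h i)"
    unfolding F sum_subtractf sum_p ..
  also have "\<dots> \<le> (\<Sum>i<n. max 0 (Re ((mat_adjoint U * (P * (\<rho> - \<sigma>) * P) * U) $$ (i, i))))"
  proof (rule sum_mono)
    fix i assume "i \<in> {..<n}"
    then have i: "i < n" by simp
    have "p i * min 1 ((g i)\<^sup>2) \<le> p i * h i"
      by (rule mult_left_mono[OF h_ge[OF i] p0[OF i]])
    then show "p i - p i * h i \<le> max 0 (Re ((mat_adjoint U * (P * (\<rho> - \<sigma>) * P) * U) $$ (i, i)))"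
      unfolding diff[OF i] by (auto simp: min_def max_def mult.commute split: if_splits)
  qed
  also have "\<dots> \<le> 1/2 * trace_norm (\<rho> - \<sigma>)"
  proof (rule sum_pos_diag_compression_le_trace_norm[OF _ _ _ P U])
    show "mat_adjoint (\<rho> - \<sigma>) = \<rho> - \<sigma>"
      by (simp add: mat_adjoint_minus[of _ n n] herm)
    have "mat_trace (\<rho> - \<sigma>) = mat_trace \<rho> - mat_trace \<sigma>"
      using carrier_matD[of \<rho> n n] carrier_matD[of \<sigma> n n]
      by (simp add: mat_trace_def flip: sum_subtractf)
    then show "mat_trace (\<rho> - \<sigma>) = 0" using tr by simp
  qed (rule minus_carrier_mat, simp)
  finally show ?thesis .
qed

end
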